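(* Let $\mathcal I=(t,m,n,\mathcal X,\mathcal X^{(S)},R)$ be an instance of the ICCSI problem over $\mathbb F_q$. The minimum length $N$ of an $\mathbb F_q$-linear $\mathcal I$-IC is equal to the min-rank $$\kappa(\mathcal I)=\min\{\operatorname{rank}(A+R):A\in\mathbb F_q^{m\times n},\ A_i\in\mathcal X^{(i)}\cap\mathcal X^{(S)}\ \text{for all } i\in[m]\}.$$
   Context: Notation: $q$ is a prime power, $\mathbb F_q$ the field with $q$ elements, $[m]=\{1,\dots,m\}$. For a matrix $A$, $A_i$ is its $i$-th row and $\langle A\rangle$ its row space. Instance: an instance $\mathcal I=(t,m,n,\mathcal X,\mathcal X^{(S)},R)$ of the Index Coding with Coded Side Information (ICCSI) problem consists of positive integers $t,m,n$; subspaces $\mathcal X^{(S)}$ and $\mathcal X^{(i)}$ ($i\in[m]$) of $\mathbb F_q^n$ of dimensions $d_S$ and $d_i$; $\mathcal X=\{A\in\mathbb F_q^{m\times n}:A_i\in\mathcal X^{(i)},\ i\in[m]\}$; and a matrix $R\in\mathbb F_q^{m\times n}$ with rows $R_i\in\mathcal X^{(S)}\setminus\mathcal X^{(i)}$. Fix matrices $V^{(S)}\in\mathbb F_q^{d_S\times n}$ and $V^{(i)}\in\mathbb F_q^{d_i\times n}$ with $\langle V^{(S)}\rangle=\mathcal X^{(S)}$, $\langle V^{(i)}\rangle=\mathcal X^{(i)}$. Index codes: for a positive integer $N$, a map $E:\mathbb F_q^{n\times t}\to\mathbb F_q^{N\times t}$ is an $\mathcal I$-IC of length $N$ if for each $i\in[m]$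 there is a decoding map $D_i:\mathbb F_q^{N\times t}\times\mathbb F_q^{d_i\times t}\to\mathbb F_q^t$ with $D_i(E(X),V^{(i)}X)=R_iX$ for all $X\in\mathbb F_q^{n\times t}$. It is $\mathbb F_q$-linear if $E(X)=LV^{(S)}X$ for some $L\in\mathbb F_q^{N\times d_S}$; then $L$ is said to represent $E$. *)

theory Defs
  imports "Jordan_Normal_Form.DL_Rank" "HOL-Library.FuncSet"
begin

text \<open>
  The field with q elements is a type of class field and finite, q being its cardinality.
  Vectors and matrices carry their dimensions as natural numbers, so that zero-dimensional side
  information (a matrix with no rows) is covered. Receivers and matrix rows are indexed by
  0, ..., m - 1; the values of the families below at indices outside this range are irrelevant.
\<close>

record 'a iccsi =
  blocks :: nat
  receivers :: nat
  msg_len :: nat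
  side_space :: "nat \<Rightarrow> 'a vec set"
  side_mats :: "'a mat set"
  sender_space :: "'a vec set"
  request :: "'a mat"

definition subspace_of_vec :: "nat \<Rightarrow> 'a::field vec set \<Rightarrow> bool" where
  "subspace_of_vec n W \<longleftrightarrow> VectorSpace.subspace class_ring W (module_vec TYPE('a) n)"

definition subspace_dim :: "nat \<Rightarrow> 'a::field vec set \<Rightarrow> nat" where
  "subspace_dim n W = vectorspace.dim class_ring ((module_vec TYPE('a) n)\<lparr>carrier := W\<rparr>)"

definition iccsi_instance :: "'a::{field,finite} iccsi \<Rightarrow> bool" where
  "iccsi_instance I \<longleftrightarrow>
     0 < blocks I \<and> 0 < receivers I \<and> 0 < msg_len I \<and>
     subspace_of_vec (msg_len I) (sender_space I) \<and>
     (\<forall>i<receivers I. subspace_of_vec (msg_len I) (side_space I i)) \<and>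
     side_mats I =
       {A \<in> carrier_mat (receivers I) (msg_len I). \<forall>i<receivers I. row A i \<in> side_space I i} \<and>
     request I \<in> carrier_mat (receivers I) (msg_len I) \<and>
     (\<forall>i<receivers I. row (request I) i \<in> sender_space I - side_space I i)"

abbreviation sender_dim :: "'a::field iccsi \<Rightarrow> nat" where
  "sender_dim I \<equiv> subspace_dim (msg_len I) (sender_space I)"

abbreviation side_dim :: "'a::field iccsi \<Rightarrow> nat \<Rightarrow> nat" where
  "side_dim I i \<equiv> subspace_dim (msg_len I) (side_space I i)"

definition generator_mats :: "'a::field iccsi \<Rightarrow> 'a mat \<Rightarrow> (nat \<Rightarrow> 'a mat) \<Rightarrow> bool" where
  "generator_mats I VS V \<longleftrightarrow>
     VS \<in> carrier_mat (sender_dim I) (msg_len I) \<and>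
     vec_space.row_space (msg_len I) VS = sender_space I \<and>
     (\<forall>i<receivers I. V i \<in> carrier_mat (side_dim I i) (msg_len I) \<and>
        vec_space.row_space (msg_len I) (V i) = side_space I i)"

text \<open>The product of the i-th row of the request matrix R with X is the i-th row of R * X.\<close>

definition index_code ::
  "'a::field iccsi \<Rightarrow> (nat \<Rightarrow> 'a mat) \<Rightarrow> nat \<Rightarrow> ('a mat \<Rightarrow> 'a mat) \<Rightarrow> bool" where
  "index_code I V N E \<longleftrightarrow>
     0 < N \<and>
     E \<in> carrier_mat (msg_len I) (blocks I) \<rightarrow> carrier_mat N (blocks I) \<and>
     (\<forall>i<receivers I.
        \<exists>D \<in> carrier_mat N (blocks I) \<rightarrow>
               carrier_mat (side_dim I i) (blocks I) \<rightarrow> carrier_vec (blocks I).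
          \<forall>X \<in> carrier_mat (msg_len I) (blocks I). D (E X) (V i * X) = row (request I * X) i)"

definition represents ::
  "'a::field iccsi \<Rightarrow> 'a mat \<Rightarrow> nat \<Rightarrow> 'a mat \<Rightarrow> ('a mat \<Rightarrow> 'a mat) \<Rightarrow> bool" where
  "represents I VS N L E \<longleftrightarrow>
     L \<in> carrier_mat N (sender_dim I) \<and>
     (\<forall>X \<in> carrier_mat (msg_len I) (blocks I). E X = L * VS * X)"

definition linear_index_code ::
  "'a::field iccsi \<Rightarrow> 'a mat \<Rightarrow> (nat \<Rightarrow> 'a mat) \<Rightarrow> nat \<Rightarrow> ('a mat \<Rightarrow> 'a mat) \<Rightarrow> bool" where
  "linear_index_code I VS V N E \<longleftrightarrow> index_code I V N E \<and> (\<exists>L. represents I VS N L E)"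

text \<open>
  The set is finite and nonempty (take A = 0), so the minimum is attained. The first argument of
  the library's rank is the number of rows.
\<close>

definition min_rank :: "'a::{field,finite} iccsi \<Rightarrow> nat" where
  "min_rank I = Min {vec_space.rank (receivers I) (A + request I) | A.
     A \<in> carrier_mat (receivers I) (msg_len I) \<and>
     (\<forall>i<receivers I. row A i \<in> side_space I i \<inter> sender_space I)}"

end

(* Rank factorization links the two sides. If A + R has rank k, then A + R = P Q with Q = P' (A + R),
   so the rows of Q lie in the sender space; sending Q X lets receiver i compute R_i X as
   P_i (Q X) - A_i X. Conversely, if a code sends Q X, then every x annihilated by Q and by V^(i)
   is confused with 0 by receiver i, so R_i x = 0; by duality R_i lies in the sum of <Q> and X^(i),
   and subtracting the components in X^(i) leaves a matrix A + R whose rows lie in <Q>. *)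

theory Submission
  imports Defs
begin

section \<open>Linear algebra: duality, factorization through a row space, rank
  factorization\<close>

lemma row_mult_eq_transpose_mult_vec:
  fixes A B :: "'a::comm_semiring_0 mat"
  assumes "A \<in> carrier_mat m n" and "B \<in> carrier_mat n k" and "i < m"
  shows "row (A * B) i = B\<^sup>T *\<^sub>v row A i"
  using assms by (intro eq_vecI) (auto simp: comm_scalar_prod[of _ n])

context vec_space
begin

lemma zero_in_span: "0\<^sub>v n \<in> span W"
  by (rule in_spanI[of _ "\<lambda>_. 0" "{}"]) auto

lemma in_span_if_annihilated:
  assumes "finite W" and "W \<subseteq> carrier_vec n" and "v \<in> carrier_vec n"
    and "\<And>x. x \<in> carrier_vec n \<Longrightarrow> \<forall>w\<in>W. w \<bullet> x = 0 \<Longrightarrow> v \<bullet> x = 0"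
  shows "v \<in> span W"
  using assms
proof (induction W arbitrary: v rule: finite_induct)
  case empty
  have "v $ i = 0" if "i < n" for i
    using empty.prems(3)[of "unit_vec n i"] empty.prems(2) that by simp
  then have "v = 0\<^sub>v n"
    using empty.prems(2) by (intro eq_vecI) auto
  then show ?case
    using zero_in_span by simp
next
  case (insert w W)
  have w: "w \<in> carrier_vec n" and W: "W \<subseteq> carrier_vec n"
    using insert.prems(1) by auto
  show ?case
  proof (cases "\<exists>x0\<in>carrier_vec n. (\<forall>u\<in>W. u \<bullet> x0 = 0) \<and> w \<bullet> x0 \<noteq> 0")
    case True
    then obtain x0 where x0: "x0 \<in> carrier_vec n" "\<forall>u\<in>W. u \<bullet> x0 = 0" "w \<bullet> x0 \<noteq> 0"
      by blast
    define c where "c = v \<bullet> x0 / (w \<bullet> x0)"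
    \<comment> \<open>Subtracting a multiple of \<^term>\<open>w\<close> makes \<^term>\<open>v\<close> vanish at \<^term>\<open>x0\<close>, hence on the
      whole annihilator of \<^term>\<open>W\<close>, which is spanned by \<^term>\<open>x0\<close> and the annihilator of
      \<^term>\<open>insert w W\<close>.\<close>
    have "v - c \<cdot>\<^sub>v w \<in> span W"
    proof (rule insert.IH[OF W])
      show "v - c \<cdot>\<^sub>v w \<in> carrier_vec n"
        using w insert.prems(2) by simp
      fix x assume x: "x \<in> carrier_vec n" "\<forall>u\<in>W. u \<bullet> x = 0"
      define d where "d = w \<bullet> x / (w \<bullet> x0)"
      have expand: "u \<bullet> (x - d \<cdot>\<^sub>v x0) = u \<bullet> x - d * (u \<bullet> x0)" if "u \<in> carrier_vec n" for u
        using that x(1) x0(1) by (simp add: scalar_prod_minus_distrib)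
      have "u \<bullet> (x - d \<cdot>\<^sub>v x0) = 0" if "u \<in> insert w W" for u
        using that expand[of u] w W x(2) x0(2,3) by (auto simp: d_def)
      then have "v \<bullet> (x - d \<cdot>\<^sub>v x0) = 0"
        using insert.prems(3) x(1) x0(1) by simp
      then have "v \<bullet> x = d * (v \<bullet> x0)"
        using expand insert.prems(2) by simp
      then show "(v - c \<cdot>\<^sub>v w) \<bullet> x = 0"
        using x(1) w insert.prems(2) by (simp add: minus_scalar_prod_distrib c_def d_def)
    qed
    then have "v - c \<cdot>\<^sub>v w \<in> span (insert w W)"
      using span_is_monotone[of W "insert w W"] by auto
    moreover have "c \<cdot>\<^sub>v w \<in> span (insert w W)"
      using insert.prems(1) by (intro smult_in_span span_mem) auto
    ultimately have "(v - c \<cdot>\<^sub>v w) + c \<cdot>\<^sub>v w \<in> span (insert w W)"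
      using insert.prems(1) span_add1 by simp
    moreover have "(v - c \<cdot>\<^sub>v w) + c \<cdot>\<^sub>v w = v"
      using w insert.prems(2) by (intro eq_vecI) auto
    ultimately show ?thesis
      by simp
  next
    case False
    \<comment> \<open>Here \<open>w\<close> vanishes wherever all of \<open>W\<close> does, so the
      hypothesis on \<open>v\<close> already holds for \<open>W\<close> alone.\<close>
    then have "v \<in> span W"
      using insert.prems by (intro insert.IH[OF W]) auto
    then show ?thesis
      using span_is_monotone[of W "insert w W"] by auto
  qed
qed

text \<open>The rows of \<open>M\<close> are the coefficient vectors that express the rows of
  \<open>B\<close> through those of \<open>C\<close>.\<close>

lemma factor_through_row_space:
  assumes C: "C \<in> carrier_mat d n" and B: "B \<in> carrier_mat m n"
    and rows: "\<And>i. i < m \<Longrightarrow> row B i \<in> row_space C"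
  obtains M where "M \<in> carrier_mat m d" and "B = M * C"
proof -
  have "\<exists>y. y \<in> carrier_vec d \<and> C\<^sup>T *\<^sub>v y = row B i" if "i < m" for i
    using rows[OF that] C unfolding row_space_eq[OF C] by auto
  then obtain y where y: "\<And>i. i < m \<Longrightarrow> y i \<in> carrier_vec d \<and> C\<^sup>T *\<^sub>v y i = row B i"
    by metis
  define M where "M = mat_of_rows d (map y [0..<m])"
  have M: "M \<in> carrier_mat m d"
    unfolding M_def by auto
  have "row M i = y i" if "i < m" for i
    using that y unfolding M_def by simp
  then have "row (M * C) i = row B i" if "i < m" for i
    using row_mult_eq_transpose_mult_vec[OF M C that] y[OF that] that by simp
  then have "B = M * C"
    using M B C by (intro eq_rowI) auto
  with M that show thesis
    by blast
qed

text \<open>Every column of \<open>P * Q\<close> is \<open>P\<close> applied to a column of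
  \<open>Q\<close>, so the column space of the product lies in that of \<open>P\<close>, which has
  only \<open>k\<close> generators.\<close>

lemma rank_mult_le:
  assumes P: "P \<in> carrier_mat n k" and Q: "Q \<in> carrier_mat k nc"
  shows "rank (P * Q) \<le> k"
proof -
  have cP: "set (cols P) \<subseteq> carrier_vec n" and cPQ: "set (cols (P * Q)) \<subseteq> carrier_vec n"
    using P cols_dim[of P] cols_dim[of "P * Q"] by auto
  have "set (cols (P * Q)) \<subseteq> span (set (cols P))"
  proof
    fix x assume "x \<in> set (cols (P * Q))"
    then obtain j where j: "j < nc" "x = col (P * Q) j"
      using Q by (auto simp: cols_def)
    then have "x = P *\<^sub>v col Q j"
      using P Q by auto
    then have "x \<in> col_space P"
      unfolding col_space_eq[OF P] using P Q j by (auto intro!: bexI[of _ "col Q j"])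
    then show "x \<in> span (set (cols P))"
      unfolding col_space_def .
  qed
  then have sub: "span (set (cols (P * Q))) \<subseteq> span (set (cols P))"
    by (rule span_subsetI[OF cP])
  have sP: "subspace class_ring (span (set (cols P))) V"
    and sPQ: "subspace class_ring (span (set (cols (P * Q)))) V"
    using cP cPQ span_is_subspace by auto
  have "rank (P * Q) \<le> rank P"
    unfolding rank_def
    using vectorspace.subspace_dim[OF subspace_is_vs[OF sP] nested_subspaces[OF sP sPQ sub]]
      fin_dim_span_cols[OF P] fin_dim_span_cols[of "P * Q" nc] P Q by auto
  with rank_le_nc[OF P] show ?thesis
    by linarith
qed

text \<open>Independent columns leave only the zero vector annihilated by the rows of
  \<open>P\<close>; by duality these rows span the whole space, and factoring the identity through
  them gives \<open>P'\<close>. Distinctness matters because independence of a set does not see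
  repeated columns.\<close>

lemma left_inverse_if_lin_indpt_cols:
  assumes P: "P \<in> carrier_mat n k" and "distinct (cols P)" and "lin_indpt (set (cols P))"
  obtains P' where "P' \<in> carrier_mat k n" and "P' * P = 1\<^sub>m k"
proof -
  \<comment> \<open>The rows of \<open>P\<close> have \<open>k\<close> entries, so duality is
    applied in dimension \<open>k\<close> and not in the ambient \<open>n\<close>.\<close>
  interpret K: vec_space f_ty k .
  have "unit_vec k i \<in> K.row_space P" if i: "i < k" for i
    unfolding K.row_space_def
  proof (rule K.in_span_if_annihilated)
    show "set (rows P) \<subseteq> carrier_vec k"
      using P by (auto simp: rows_def)
    fix x :: "'a vec"
    assume x: "x \<in> carrier_vec k" "\<forall>w\<in>set (rows P). w \<bullet> x = 0"
    then have "P *\<^sub>v x = 0\<^sub>v n"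
      using P by (intro eq_vecI) (auto simp: rows_def)
    then have "x = 0\<^sub>v k"
      using lin_depI[OF P x(1)] assms(2,3) by blast
    then show "unit_vec k i \<bullet> x = 0"
      by simp
  qed auto
  then have "row (1\<^sub>m k) i \<in> K.row_space P" if "i < k" for i
    using that by simp
  from K.factor_through_row_space[OF P one_carrier_mat this] show thesis
    using that by metis
qed

text \<open>The right factor has the form \<open>P' * B\<close> so that its rows are combinations of
  rows of \<open>B\<close>: any subspace containing the rows of \<open>B\<close> contains them too.
  The columns of \<open>P\<close> are a maximal independent set of columns of
  \<open>B\<close>.\<close>

lemma rank_factorization:
  assumes B: "B \<in> carrier_mat n nc"
  obtains P P' where "P \<in> carrier_mat n (rank B)" and "P' \<in> carrier_mat (rank B) n"
    and "B = P * (P' * B)"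
proof -
  have cB: "set (cols B) \<subseteq> carrier_vec n"
    using B cols_dim by blast
  obtain S where S: "maximal S (\<lambda>T. T \<subseteq> set (cols B) \<and> lin_indpt T)"
    using maximal_exists[of "(\<lambda>T. T \<subseteq> set (cols B) \<and> lin_indpt T)" "card (set (cols B))" "{}"]
    by (meson List.finite_set card_mono empty_iff empty_subsetI finite_lin_indpt2 rev_finite_subset)
  then have SB: "S \<subseteq> set (cols B)" and li: "lin_indpt S"
    by (auto simp: maximal_def)
  have finS: "finite S"
    using SB finite_subset by blast
  obtain xs where xs: "set xs = S" "distinct xs"
    using finite_distinct_list[OF finS] by blast
  have rk: "length xs = rank B"
    using rank_card_indpt[OF B S] distinct_card[OF xs(2)] xs(1) by simp
  define P where "P = mat_of_cols n xs"
  have P: "P \<in> carrier_mat n (rank B)"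
    unfolding P_def rk[symmetric] by auto
  have cP: "cols P = xs"
    unfolding P_def using xs(1) SB cB by (intro cols_mat_of_cols) auto
  have "set (cols B) \<subseteq> col_space P"
  proof
    fix v assume v: "v \<in> set (cols B)"
    show "v \<in> col_space P"
    proof (rule ccontr)
      have cS: "S \<subseteq> carrier_vec n" and vc: "v \<in> carrier_vec n"
        using SB cB v by auto
      assume "v \<notin> col_space P"
      then have nspan: "v \<notin> span S"
        unfolding col_space_def cP xs(1) .
      then have "v \<notin> S"
        using span_mem[OF cS] by blast
      \<comment> \<open>A column outside the span of \<open>S\<close> could be added to
        \<open>S\<close>, against maximality.\<close>
      then have "lin_indpt (S \<union> {v})"
        using lin_dep_iff_in_span[OF cS li vc \<open>v \<notin> S\<close>] nspan by simp
      then have "S \<union> {v} = S"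
        using S SB v unfolding maximal_def by blast
      then show False
        using \<open>v \<notin> S\<close> by blast
    qed
  qed
  \<comment> \<open>Passing to transposes turns columns into rows, where the factorization lemma
    applies.\<close>
  then have colB: "row B\<^sup>T j \<in> vec_space.row_space n P\<^sup>T" if "j < nc" for j
    using B that unfolding col_space_eq_row_space_transpose by (auto simp: cols_def)
  obtain M where M: "M \<in> carrier_mat nc (rank B)" "B\<^sup>T = M * P\<^sup>T"
    using factor_through_row_space[of "P\<^sup>T" "rank B" "B\<^sup>T" nc] P B colB by auto
  have BP: "B = P * M\<^sup>T"
    using transpose_mult[OF M(1), of "P\<^sup>T" n] M(2) P by (metis transpose_transpose transpose_carrier_mat)
  obtain P' where P': "P' \<in> carrier_mat (rank B) n" "P' * P = 1\<^sub>m (rank B)"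
    using left_inverse_if_lin_indpt_cols[OF P] cP xs li by auto
  have "P' * B = P' * (P * M\<^sup>T)"
    using BP by simp
  also have "\<dots> = M\<^sup>T"
    using P' P M(1) by (simp add: assoc_mult_mat[symmetric, of _ _ n _ "rank B" _ nc])
  finally have "B = P * (P' * B)"
    using BP by simp
  then show thesis
    using that P P'(1) by blast
qed

lemma span_union_decompose:
  assumes "A \<subseteq> carrier_vec n" and "B \<subseteq> carrier_vec n" and "v \<in> span (A \<union> B)"
  obtains a b where "a \<in> span A" and "b \<in> span B" and "v = a + b"
proof -
  have "span (A \<union> B) = submodule_sum (span A) (span B)"
    using assms(1,2) by (intro span_union_is_sum) auto
  with assms(3) that show thesis
    unfolding submodule_sum_def by auto
qed

end

section \<open>Achievability: a linear code whose length is the rank of \<open>A + R\<close>\<close>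

lemma ex_linear_index_code_of_length_rank:
  fixes I :: "'a::{field,finite} iccsi"
  assumes inst: "iccsi_instance I" and gen: "generator_mats I VS V"
    and A: "A \<in> carrier_mat (receivers I) (msg_len I)"
    and rows: "\<forall>i<receivers I. row A i \<in> side_space I i \<inter> sender_space I"
  shows "\<exists>E. linear_index_code I VS V (vec_space.rank (receivers I) (A + request I)) E"
proof -
  let ?m = "receivers I" and ?n = "msg_len I" and ?t = "blocks I" and ?d = "sender_dim I"
  let ?R = "request I"
  interpret N: vec_space "TYPE('a)" ?n .
  interpret M: vec_space "TYPE('a)" ?m .
  let ?B = "A + ?R"
  let ?k = "M.rank ?B"
  have R: "?R \<in> carrier_mat ?m ?n" and m: "0 < ?m"
    and Rrow: "\<And>i. i < ?m \<Longrightarrow> row ?R i \<in> sender_space I - side_space I i"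
    using inst by (auto simp: iccsi_instance_def)
  have VS: "VS \<in> carrier_mat ?d ?n" and VSsp: "N.row_space VS = sender_space I"
    and Vi: "\<And>i. i < ?m \<Longrightarrow> V i \<in> carrier_mat (side_dim I i) ?n"
    and Visp: "\<And>i. i < ?m \<Longrightarrow> N.row_space (V i) = side_space I i"
    using gen by (auto simp: generator_mats_def)
  have B: "?B \<in> carrier_mat ?m ?n"
    using A R by simp
  have rowB: "row ?B i = row A i + row ?R i" if "i < ?m" for i
    using A R that by (intro eq_vecI) auto
  have cVS: "set (rows VS) \<subseteq> carrier_vec ?n"
    using VS by (auto simp: rows_def)
  \<comment> \<open>Both summands of each row lie in the sender space. The resulting
    \<open>G\<close> is what allows \<open>Q\<close> to be written as \<open>L * VS\<close>, with
    \<open>L = P' * G\<close>.\<close>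
  have "row ?B i \<in> N.row_space VS" if "i < ?m" for i
    using rows Rrow[OF that] that cVS VSsp N.span_add1[OF cVS]
    unfolding rowB[OF that] N.row_space_def by auto
  then obtain G where G: "G \<in> carrier_mat ?m ?d" "?B = G * VS"
    using N.factor_through_row_space[OF VS B] by metis
  obtain P P' where P: "P \<in> carrier_mat ?m ?k" and P': "P' \<in> carrier_mat ?k ?m"
    and PP': "?B = P * (P' * ?B)"
    using M.rank_factorization[OF B] by metis
  define Q where Q: "Q = P' * ?B"
  have PQ: "?B = P * Q"
    using PP' unfolding Q .
  have Qc: "Q \<in> carrier_mat ?k ?n"
    using Q P' B by simp
  define L where "L = P' * G"
  have L: "L \<in> carrier_mat ?k ?d"
    using P' G by (simp add: L_def)
  have QL: "Q = L * VS"
    unfolding L_def Q G(2) using P' G VS by simp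
  \<comment> \<open>A code must have positive length. Rank 0 would force the rows of
    \<open>A\<close> and \<open>R\<close> at index 0 to be opposite, placing the request of receiver
    0 in its own side space.\<close>
  have kpos: "0 < ?k"
  proof (rule ccontr)
    assume "\<not> 0 < ?k"
    then have k0: "?k = 0"
      by simp
    have "row ?B 0 = 0\<^sub>v ?n"
    proof (rule eq_vecI)
      fix j assume "j < dim_vec (0\<^sub>v ?n :: 'a vec)"
      then have j: "j < ?n"
        by simp
      have "row ?B 0 $ j = (P * Q) $$ (0, j)"
        unfolding PQ using P Qc m j by simp
      also have "\<dots> = row P 0 \<bullet> col Q j"
        using P Qc m j by simp
      also have "\<dots> = 0"
        using P Qc k0 by (auto simp: scalar_prod_def)
      finally show "row ?B 0 $ j = (0\<^sub>v ?n :: 'a vec) $ j"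
        using j by simp
    qed (use B in auto)
    then have z: "row A 0 + row ?R 0 = 0\<^sub>v ?n"
      using rowB m by simp
    have "row ?R 0 = (- 1) \<cdot>\<^sub>v row A 0"
    proof (rule eq_vecI)
      fix j assume "j < dim_vec ((- 1) \<cdot>\<^sub>v row A 0)"
      then have j: "j < ?n"
        using A by simp
      have "(row A 0 + row ?R 0) $ j = 0"
        using z j by simp
      then have "row A 0 $ j + row ?R 0 $ j = 0"
        using R j by simp
      then show "row ?R 0 $ j = ((- 1) \<cdot>\<^sub>v row A 0) $ j"
        using A j by (simp add: add_eq_0_iff)
    qed (use A R in auto)
    moreover have "row A 0 \<in> N.span (set (rows (V 0)))"
      using rows m Visp unfolding N.row_space_def by blast
    moreover have "set (rows (V 0)) \<subseteq> carrier_vec ?n"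
      using Vi[OF m] by (auto simp: rows_def)
    ultimately have "row ?R 0 \<in> N.span (set (rows (V 0)))"
      using N.smult_in_span by metis
    then show False
      using Rrow[OF m] Visp[OF m] unfolding N.row_space_def by blast
  qed
  define E where "E X = Q * X" for X
  have E: "E \<in> carrier_mat ?n ?t \<rightarrow> carrier_mat ?k ?t"
    using Qc by (auto simp: E_def)
  have dec: "\<exists>D \<in> carrier_mat ?k ?t \<rightarrow> carrier_mat (side_dim I i) ?t \<rightarrow> carrier_vec ?t.
      \<forall>X \<in> carrier_mat ?n ?t. D (E X) (V i * X) = row (?R * X) i" if i: "i < ?m" for i
  proof -
    have "row A i \<in> N.row_space (V i)"
      using rows i Visp by blast
    \<comment> \<open>These coefficients let receiver \<open>i\<close> compute the product of row
      \<open>i\<close> of \<open>A\<close> with \<open>X\<close> from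
      \<open>V i * X\<close>.\<close>
    then obtain a where a: "a \<in> carrier_vec (side_dim I i)" "(V i)\<^sup>T *\<^sub>v a = row A i"
      using N.row_space_eq[OF Vi[OF i]] Vi[OF i] by auto
    \<comment> \<open>In row notation this is row \<open>i\<close> of \<open>P\<close> times
      \<open>Y\<close>, minus \<open>a\<close> times \<open>Z\<close>; the transposes appear because
      rows are represented as column vectors.\<close>
    define D where "D Y Z = Y\<^sup>T *\<^sub>v row P i - Z\<^sup>T *\<^sub>v a" for Y Z :: "'a mat"
    have "D \<in> carrier_mat ?k ?t \<rightarrow> carrier_mat (side_dim I i) ?t \<rightarrow> carrier_vec ?t"
      unfolding D_def by (intro Pi_I carrier_vecI) simp
    moreover have "D (E X) (V i * X) = row (?R * X) i" if X: "X \<in> carrier_mat ?n ?t" for X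
    proof -
      have XT: "X\<^sup>T \<in> carrier_mat ?t ?n"
        using X by simp
      have rowP: "row P i \<in> carrier_vec ?k" and rA: "row A i \<in> carrier_vec ?n"
        and rR: "row ?R i \<in> carrier_vec ?n"
        using P A R by (auto intro!: carrier_vecI)
      have "(Q * X)\<^sup>T *\<^sub>v row P i = X\<^sup>T *\<^sub>v (Q\<^sup>T *\<^sub>v row P i)"
        unfolding transpose_mult[OF Qc X] using Qc XT rowP by (intro assoc_mult_mat_vec) auto
      also have "Q\<^sup>T *\<^sub>v row P i = row ?B i"
        using row_mult_eq_transpose_mult_vec[OF P Qc i] PQ by simp
      finally have 1: "(Q * X)\<^sup>T *\<^sub>v row P i = X\<^sup>T *\<^sub>v row A i + X\<^sup>T *\<^sub>v row ?R i"
        unfolding rowB[OF i] mult_add_distrib_mat_vec[OF XT rA rR] .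
      have 2: "(V i * X)\<^sup>T *\<^sub>v a = X\<^sup>T *\<^sub>v row A i"
        unfolding transpose_mult[OF Vi[OF i] X] a(2)[symmetric]
        using Vi[OF i] XT a(1) by (intro assoc_mult_mat_vec) auto
      have "D (E X) (V i * X) = X\<^sup>T *\<^sub>v row ?R i"
        unfolding D_def E_def 1 2 using X by (intro eq_vecI) auto
      then show ?thesis
        using row_mult_eq_transpose_mult_vec[OF R X i] by simp
    qed
    ultimately show ?thesis
      by blast
  qed
  have "index_code I V ?k E"
    unfolding index_code_def using kpos E dec by blast
  moreover have "represents I VS ?k L E"
    unfolding represents_def using L QL by (simp add: E_def)
  ultimately show ?thesis
    unfolding linear_index_code_def by blast
qed

section \<open>Converse: every linear code yields an admissible \<open>A\<close> of small
  rank\<close>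

lemma ex_rank_le_length_of_linear_index_code:
  fixes I :: "'a::{field,finite} iccsi"
  assumes inst: "iccsi_instance I" and gen: "generator_mats I VS V"
    and code: "linear_index_code I VS V N E"
  shows "\<exists>A \<in> carrier_mat (receivers I) (msg_len I).
    (\<forall>i<receivers I. row A i \<in> side_space I i \<inter> sender_space I) \<and>
    vec_space.rank (receivers I) (A + request I) \<le> N"
proof -
  let ?m = "receivers I" and ?n = "msg_len I" and ?t = "blocks I" and ?d = "sender_dim I"
  let ?R = "request I"
  interpret N: vec_space "TYPE('a)" ?n .
  interpret M: vec_space "TYPE('a)" ?m .
  have R: "?R \<in> carrier_mat ?m ?n" and t: "0 < ?t"
    and Rrow: "\<And>i. i < ?m \<Longrightarrow> row ?R i \<in> sender_space I"
    using inst by (auto simp: iccsi_instance_def)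
  have VS: "VS \<in> carrier_mat ?d ?n" and VSsp: "N.row_space VS = sender_space I"
    and Vi: "\<And>i. i < ?m \<Longrightarrow> V i \<in> carrier_mat (side_dim I i) ?n"
    and Visp: "\<And>i. i < ?m \<Longrightarrow> N.row_space (V i) = side_space I i"
    using gen by (auto simp: generator_mats_def)
  have cVS: "set (rows VS) \<subseteq> carrier_vec ?n"
    using VS by (auto simp: rows_def)
  obtain L where L: "L \<in> carrier_mat N ?d"
    and EL: "\<And>X. X \<in> carrier_mat ?n ?t \<Longrightarrow> E X = L * VS * X"
    using code by (auto simp: linear_index_code_def represents_def)
  define Q where "Q = L * VS"
  have Q: "Q \<in> carrier_mat N ?n"
    using L VS by (simp add: Q_def)
  have cQ: "set (rows Q) \<subseteq> carrier_vec ?n"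
    using Q by (auto simp: rows_def)
  \<comment> \<open>Encoding through \<open>VS\<close> keeps the rows of \<open>Q\<close> in the
    sender space; this will put the rows of \<open>A\<close> there as well.\<close>
  have "set (rows Q) \<subseteq> N.row_space VS"
  proof
    fix x assume "x \<in> set (rows Q)"
    then obtain j where j: "j < N" "x = row Q j"
      using Q by (auto simp: rows_def)
    from j have "x = VS\<^sup>T *\<^sub>v row L j"
      using row_mult_eq_transpose_mult_vec[OF L VS] by (simp add: Q_def)
    then show "x \<in> N.row_space VS"
      unfolding N.row_space_eq[OF VS] using VS L j(1)
      by (auto intro!: bexI[of _ "row L j"])
  qed
  then have Qsub: "N.span (set (rows Q)) \<subseteq> N.span (set (rows VS))"
    unfolding N.row_space_def by (rule N.span_subsetI[OF cVS])
  have "\<exists>a. a \<in> side_space I i \<inter> sender_space I \<and> a \<in> carrier_vec ?n \<and>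
      a + row ?R i \<in> N.row_space Q" if i: "i < ?m" for i
  proof -
    have cV: "set (rows (V i)) \<subseteq> carrier_vec ?n"
      using Vi[OF i] by (auto simp: rows_def)
    have rR: "row ?R i \<in> carrier_vec ?n"
      using R by (auto intro!: carrier_vecI)
    obtain D where D: "\<And>X. X \<in> carrier_mat ?n ?t \<Longrightarrow> D (E X) (V i * X) = row (?R * X) i"
      using code i unfolding linear_index_code_def index_code_def by blast
    have "row ?R i \<in> N.span (set (rows Q) \<union> set (rows (V i)))"
    proof (rule N.in_span_if_annihilated)
      fix x assume x: "x \<in> carrier_vec ?n"
        and ann: "\<forall>w\<in>set (rows Q) \<union> set (rows (V i)). w \<bullet> x = 0"
      \<comment> \<open>The message with all columns equal to \<^term>\<open>x\<close> looks to receiver \<^term>\<open>i\<close> like the zero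
        message.\<close>
      define X where "X = mat ?n ?t (\<lambda>(j, _). x $ j)"
      have X: "X \<in> carrier_mat ?n ?t"
        by (simp add: X_def)
      have colX: "col X j = x" if "j < ?t" for j
        using that x by (intro eq_vecI) (auto simp: X_def)
      have Z: "0\<^sub>m ?n ?t \<in> carrier_mat ?n ?t"
        by simp
      have "Q * X = Q * 0\<^sub>m ?n ?t"
        using Q X ann colX by (intro eq_matI) (auto simp: rows_def)
      then have "E X = E (0\<^sub>m ?n ?t)"
        unfolding EL[OF X] EL[OF Z] Q_def .
      moreover have "V i * X = V i * 0\<^sub>m ?n ?t"
        using Vi[OF i] X ann colX by (intro eq_matI) (auto simp: rows_def)
      ultimately have "row (?R * X) i = row (?R * 0\<^sub>m ?n ?t) i"
        using D[OF X] D[OF Z] by simp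
      \<comment> \<open>Any single entry suffices; entry 0 exists because the number of blocks is
        positive.\<close>
      then have "row (?R * X) i $ 0 = row (?R * 0\<^sub>m ?n ?t) i $ 0"
        by simp
      then show "row ?R i \<bullet> x = 0"
        using R X i t colX by simp
    qed (use cQ cV rR in auto)
    then obtain q b where q: "q \<in> N.span (set (rows Q))" and b: "b \<in> N.span (set (rows (V i)))"
      and sum: "row ?R i = q + b"
      using N.span_union_decompose[OF cQ cV] by metis
    have qc: "q \<in> carrier_vec ?n" and bc: "b \<in> carrier_vec ?n"
      using q b cQ cV N.span_is_subset2 by blast+
    \<comment> \<open>With this sign \<open>a\<close> cancels the side-space component of the
      request, leaving \<open>q\<close>. Membership in the side space is read off from
      \<open>b\<close>, membership in the sender space from \<open>a\<close> being \<open>q\<close>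
      minus the request.\<close>
    define a where "a = (- 1) \<cdot>\<^sub>v b"
    have "a \<in> side_space I i"
      using N.smult_in_span[OF cV b] Visp[OF i] by (simp add: a_def N.row_space_def)
    moreover have "a = q + (- 1) \<cdot>\<^sub>v row ?R i"
      unfolding a_def sum using qc bc by (intro eq_vecI) auto
    then have "a \<in> sender_space I"
      using q Qsub Rrow[OF i] VSsp N.span_add1[OF cVS] N.smult_in_span[OF cVS]
      by (auto simp: N.row_space_def)
    moreover have "a + row ?R i = q"
      unfolding a_def sum using qc bc by (intro eq_vecI) auto
    moreover have "a \<in> carrier_vec ?n"
      using bc by (simp add: a_def)
    ultimately show ?thesis
      using q unfolding N.row_space_def by auto
  qed
  then obtain a where a: "\<And>i. i < ?m \<Longrightarrow> a i \<in> side_space I i \<inter> sender_space I \<and>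
      a i \<in> carrier_vec ?n \<and> a i + row ?R i \<in> N.row_space Q"
    by metis
  define A where "A = mat_of_rows ?n (map a [0..<?m])"
  have A: "A \<in> carrier_mat ?m ?n"
    unfolding A_def by auto
  have rowA: "row A i = a i" if "i < ?m" for i
    using that a unfolding A_def by simp
  have "row (A + ?R) i = a i + row ?R i" if "i < ?m" for i
    using A R that rowA[OF that, symmetric] by (intro eq_vecI) auto
  \<comment> \<open>The inner dimension of this factorization is \<open>N\<close>, which bounds the
    rank.\<close>
  then obtain P where "P \<in> carrier_mat ?m N" "A + ?R = P * Q"
    using N.factor_through_row_space[OF Q, of "A + ?R" ?m] A R a by auto
  then have "M.rank (A + ?R) \<le> N"
    using M.rank_mult_le Q by metis
  then show ?thesis
    using A rowA a by (intro bexI[of _ A]) auto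
qed

section \<open>The minimum: both bounds combined\<close>

theorem mainTheorem2:
  fixes I :: "'a::{field,finite} iccsi"
    and VS :: "'a mat" and V :: "nat \<Rightarrow> 'a mat"
  assumes "iccsi_instance I"
    and "generator_mats I VS V"
  shows "(\<exists>N E. linear_index_code I VS V N E) \<and>
         (LEAST N. \<exists>E. linear_index_code I VS V N E) = min_rank I"
proof -
  let ?m = "receivers I" and ?n = "msg_len I"
  interpret N: vec_space "TYPE('a)" ?n .
  interpret M: vec_space "TYPE('a)" ?m .
  define adm where "adm A \<longleftrightarrow> A \<in> carrier_mat ?m ?n \<and>
     (\<forall>i<?m. row A i \<in> side_space I i \<inter> sender_space I)" for A
  define K where "K = {M.rank (A + request I) | A. adm A}"
  have min: "min_rank I = Min K"
    by (simp add: min_rank_def K_def adm_def)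
  have R: "request I \<in> carrier_mat ?m ?n"
    using assms(1) by (simp add: iccsi_instance_def)
  \<comment> \<open>\<open>Min\<close> is attained only on a finite nonempty set: ranks are bounded
    by the number of columns, and the zero matrix is admissible because zero lies in every row
    space.\<close>
  have "K \<subseteq> {..?n}"
    using M.rank_le_nc R by (auto simp: K_def adm_def)
  then have fin: "finite K"
    using finite_subset by blast
  have "0\<^sub>v ?n \<in> N.row_space W" for W
    unfolding N.row_space_def by (rule N.zero_in_span)
  then have "adm (0\<^sub>m ?m ?n)"
    using assms(2) unfolding adm_def generator_mats_def by auto
  then have "K \<noteq> {}"
    by (auto simp: K_def)
  then have "Min K \<in> K"
    using fin by (rule Min_in[rotated])
  then have code: "\<exists>E. linear_index_code I VS V (Min K) E"
    using ex_linear_index_code_of_length_rank[OF assms] by (auto simp: K_def adm_def)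
  have "Min K \<le> N" if "\<exists>E. linear_index_code I VS V N E" for N
  proof -
    from that obtain E where "linear_index_code I VS V N E" ..
    then obtain A where "adm A" "M.rank (A + request I) \<le> N"
      using ex_rank_le_length_of_linear_index_code[OF assms] unfolding adm_def by blast
    moreover from this have "Min K \<le> M.rank (A + request I)"
      using fin by (intro Min_le) (auto simp: K_def)
    ultimately show ?thesis
      by linarith
  qed
  with code have "(LEAST N. \<exists>E. linear_index_code I VS V N E) = Min K"
    by (intro Least_equality) auto
  with code show ?thesis
    unfolding min by blast
qed

end
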